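(* Let $k\ge 2$ and $n$ be positive integers with $\log_2 n\ge k$. Then the integrality gap of \textsc{Mono-LP-Rel} on instances with ground set of size $n$ and $k$ functions is at least $\frac{k}{2}-\frac{k(k-1)}{\log_2 n}$.
   Context: An instance consists of a finite set $N$ with $|N|=n$ and monotone submodular functions $f_1,\ldots,f_k:2^N\to\mathbb{R}_+$ with $f_i(\emptyset)=0$ ($f$ is submodular if $f(S)+f(T)\ge f(S\cup T)+f(S\cap T)$ for all $S,T$, monotone if $S\subseteq T$ implies $f(S)\le f(T)$). Write $[k]=\{1,\ldots,k\}$, $\chi_S$ for the characteristic vector of $S\subseteq N$ and $\mathbf{1}$ for the all-ones vector in $\mathbb{R}^N$. \textsc{Mono-LP-Rel} is the linear program: minimize $\sum_{S\subseteq N,\,i\in[k]} y_i(S) f_i(S)$ subject to $y_i\in\mathbb{R}_+^{2^N}$ for all $i$ and $\sum_{S\subseteq N,\,i\in[k]} y_i(S)\chi_S=\mathbf{1}$. For an instance let $\mathrm{OPT}=\min\{\sum_{i=1}^k f_i(X_i)\mid X_1,\ldots,X_k \text{ a partition of } N \text{ (parts possibly empty)}\}$ and $\mathrm{OPT}_{LP}$ the optimal LP value. The integrality gap is the supremum over instances of $\mathrm{OPT}/\mathrm{OPT}_{LP}$ (with the ratio taken as $+\infty$ if $\mathrm{OPT}_{LP}=0<\mathrm{OPT}$ and as $1$ if both are $0$). *)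

theory Defs
  imports Complex_Main "HOL-Library.Extended_Real" "HOL-Library.Disjoint_Sets"
    "HOL-Library.Indicator_Function"
begin

definition submodular_on :: "'a set \<Rightarrow> ('a set \<Rightarrow> real) \<Rightarrow> bool" where
  "submodular_on N f \<longleftrightarrow>
     (\<forall>S T. S \<subseteq> N \<longrightarrow> T \<subseteq> N \<longrightarrow> f S + f T \<ge> f (S \<union> T) + f (S \<inter> T))"

definition mono_instance :: "'a set \<Rightarrow> nat \<Rightarrow> (nat \<Rightarrow> 'a set \<Rightarrow> real) \<Rightarrow> bool" where
  "mono_instance N k f \<longleftrightarrow> finite N \<and>
     (\<forall>i\<in>{1..k}. (\<forall>S\<in>Pow N. f i S \<ge> 0) \<and> f i {} = 0 \<and>
        mono_on (Pow N) (f i) \<and> submodular_on N (f i))"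

definition lp_feasible :: "'a set \<Rightarrow> nat \<Rightarrow> (nat \<Rightarrow> 'a set \<Rightarrow> real) \<Rightarrow> bool" where
  "lp_feasible N k y \<longleftrightarrow>
     (\<forall>i\<in>{1..k}. \<forall>S\<in>Pow N. y i S \<ge> 0) \<and>
     (\<forall>v\<in>N. (\<Sum>i\<in>{1..k}. \<Sum>S\<in>Pow N. y i S * indicator S v) = 1)"

definition lp_cost ::
  "'a set \<Rightarrow> nat \<Rightarrow> (nat \<Rightarrow> 'a set \<Rightarrow> real) \<Rightarrow> (nat \<Rightarrow> 'a set \<Rightarrow> real) \<Rightarrow> real" where
  "lp_cost N k f y = (\<Sum>i\<in>{1..k}. \<Sum>S\<in>Pow N. y i S * f i S)"

definition opt_lp :: "'a set \<Rightarrow> nat \<Rightarrow> (nat \<Rightarrow> 'a set \<Rightarrow> real) \<Rightarrow> real" where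
  "opt_lp N k f = (INF y\<in>{y. lp_feasible N k y}. lp_cost N k f y)"

(* Parts are indexed by 1, ..., k and may be empty; the values of X outside {1..k} are irrelevant. *)
definition is_allocation :: "'a set \<Rightarrow> nat \<Rightarrow> (nat \<Rightarrow> 'a set) \<Rightarrow> bool" where
  "is_allocation N k X \<longleftrightarrow> (\<Union>i\<in>{1..k}. X i) = N \<and> disjoint_family_on X {1..k}"

definition opt_int :: "'a set \<Rightarrow> nat \<Rightarrow> (nat \<Rightarrow> 'a set \<Rightarrow> real) \<Rightarrow> real" where
  "opt_int N k f = Min {(\<Sum>i\<in>{1..k}. f i (X i)) | X. is_allocation N k X}"

definition gap_ratio :: "'a set \<Rightarrow> nat \<Rightarrow> (nat \<Rightarrow> 'a set \<Rightarrow> real) \<Rightarrow> ereal" where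
  "gap_ratio N k f =
     (if opt_lp N k f = 0 then (if opt_int N k f = 0 then 1 else \<infinity>)
      else ereal (opt_int N k f / opt_lp N k f))"

(* Every finite ground set is in bijection with a set of naturals, so ranging over all
   N :: nat set with n elements accounts for all instances up to relabelling. *)
definition integrality_gap :: "nat \<Rightarrow> nat \<Rightarrow> ereal" where
  "integrality_gap n k =
     Sup {gap_ratio N k f | (N :: nat set) f. card N = n \<and> mono_instance N k f}"

end

theory Submission
  imports Defs
begin

text \<open>
  Vertex cover in a weighted \<open>k\<close>-partite hypergraph. Part \<open>i\<close> has vertices
  \<open>0, \<dots>, m\<close>, where vertex \<open>0\<close> has the prohibitive weight \<open>k * m\<close> and the others weight \<open>1\<close>;
  the hyperedges are the tuples \<open>e\<close> with \<open>e\<^sub>1 + \<dots> + e\<^sub>k \<ge> k * m / 2\<close>. The ground set consists of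
  hyperedges, and \<open>f\<^sub>i S\<close> is the weight of the set of vertices of part \<open>i\<close> that lie on hyperedges
  in \<open>S\<close>, so an allocation is a vertex cover. Fractionally, vertex \<open>j\<close> is taken to the extent
  \<open>2 * j / (k * m)\<close>, at total cost \<open>m + 1\<close>. An integral cover avoiding all vertices \<open>0\<close> leaves a
  largest vertex \<open>a\<^sub>i\<close> of each part uncovered; these do not form a hyperedge, so the cover costs
  at least \<open>k * m - (a\<^sub>1 + \<dots> + a\<^sub>k) > k * m / 2\<close>. There are at most \<open>(m + 1) ^ k\<close> hyperedges, and
  \<open>m = \<lfloor>log 2 n / k\<rfloor>\<close> is good enough.
\<close>

section \<open>Finite surjections and tuples with a prescribed sum\<close>

text \<open>The ground set must have exactly \<open>n\<close> elements, but there may be fewer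
  hyperedges. The surplus elements all repeat one hyperedge.\<close>

lemma obtain_surj_from_lessThan:
  assumes "finite E" "E \<noteq> {}" "card E \<le> n"
  obtains g :: "nat \<Rightarrow> 'a" where "g ` {..<n} = E"
proof -
  obtain h where h: "bij_betw h {0..<card E} E"
    using ex_bij_betw_nat_finite[OF assms(1)] by blast
  have pos: "card E > 0" using assms by (simp add: card_gt_0_iff)
  have im: "h ` {0..<card E} = E" using h by (simp add: bij_betw_def)
  define g where "g v = (if v < card E then h v else h 0)" for v
  have "g ` {..<n} \<subseteq> E" using im pos by (auto simp: g_def)
  moreover have "E \<subseteq> g ` {..<n}"
  proof
    fix x assume "x \<in> E"
    then have "x \<in> h ` {0..<card E}" by (simp only: im)
    then obtain v where "v < card E" "x = h v" by auto
    then show "x \<in> g ` {..<n}" using assms(3) by (intro image_eqI[of _ _ v]) (auto simp: g_def)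
  qed
  ultimately show ?thesis using that by blast
qed

text \<open>Greedy: the new index takes as much of \<open>s\<close> as it can, namely
  \<open>min s (e x)\<close>, and the induction hypothesis distributes the rest.\<close>

lemma ex_le_with_sum_eq:
  fixes e :: "'a \<Rightarrow> nat"
  assumes "finite A" "s \<le> sum e A"
  shows "\<exists>b. (\<forall>i\<in>A. b i \<le> e i) \<and> sum b A = s"
  using assms
proof (induction A arbitrary: s rule: finite_induct)
  case empty
  then show ?case by auto
next
  case (insert x A)
  have "s - min s (e x) \<le> sum e A" using insert by simp
  then obtain b where b: "\<forall>i\<in>A. b i \<le> e i" "sum b A = s - min s (e x)"
    using insert.IH by blast
  have "sum (b(x := min s (e x))) A = sum b A" using insert.hyps by (intro sum.cong) auto
  then show ?case
    using b insert.hyps by (intro exI[of _ "b(x := min s (e x))"]) auto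
qed

section \<open>Bounds for the two optima and their ratio\<close>

lemma lp_cost_nonneg:
  assumes "mono_instance N k f" "lp_feasible N k y"
  shows "lp_cost N k f y \<ge> 0"
  using assms unfolding lp_cost_def mono_instance_def lp_feasible_def
  by (intro sum_nonneg mult_nonneg_nonneg) auto

lemma opt_lp_le_lp_cost:
  assumes "mono_instance N k f" "lp_feasible N k y"
  shows "opt_lp N k f \<le> lp_cost N k f y"
  unfolding opt_lp_def using assms lp_cost_nonneg[OF assms(1)]
  by (intro cINF_lower bdd_belowI2[where m = 0]) auto

lemma opt_lp_nonneg:
  assumes "mono_instance N k f" "lp_feasible N k y"
  shows "opt_lp N k f \<ge> 0"
  unfolding opt_lp_def using assms lp_cost_nonneg[OF assms(1)]
  by (intro cINF_greatest) auto

text \<open>\<open>Min\<close> is informative only on a finite nonempty set. The cost depends on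
  \<open>X\<close> only inside \<open>{1..k}\<close>, which leaves finitely many values, and giving
  all of \<open>N\<close> to part 1 is an allocation.\<close>

lemma le_opt_int:
  assumes "finite N" "k \<ge> 1"
    and bound: "\<And>X. is_allocation N k X \<Longrightarrow> c \<le> (\<Sum>i\<in>{1..k}. f i (X i))"
  shows "c \<le> opt_int N k f"
proof -
  let ?V = "{(\<Sum>i\<in>{1..k}. f i (X i)) | X. is_allocation N k X}"
  have "?V \<subseteq> (\<lambda>X. \<Sum>i\<in>{1..k}. f i (X i)) ` (PiE {1..k} (\<lambda>_. Pow N))"
  proof
    fix c assume "c \<in> ?V"
    then obtain X where X: "c = (\<Sum>i\<in>{1..k}. f i (X i))" "is_allocation N k X" by blast
    have "restrict X {1..k} \<in> PiE {1..k} (\<lambda>_. Pow N)"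
      using X(2) unfolding is_allocation_def by auto
    moreover have "c = (\<Sum>i\<in>{1..k}. f i (restrict X {1..k} i))" using X(1) by simp
    ultimately show "c \<in> (\<lambda>X. \<Sum>i\<in>{1..k}. f i (X i)) ` (PiE {1..k} (\<lambda>_. Pow N))" by blast
  qed
  moreover have "finite (PiE {1..k} (\<lambda>_. Pow N))"
    using assms(1) by (intro finite_PiE) auto
  ultimately have fin: "finite ?V" using finite_surj by blast
  have "is_allocation N k (\<lambda>i. if i = 1 then N else {})"
    using assms(2) unfolding is_allocation_def disjoint_family_on_def by (auto split: if_splits)
  then have "?V \<noteq> {}" by blast
  then show ?thesis unfolding opt_int_def using fin bound by (subst Min_ge_iff) auto
qed

lemma gap_ratio_ge:
  assumes inst: "mono_instance N k f" and feas: "lp_feasible N k y"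
    and cost: "lp_cost N k f y \<le> b" and opt: "opt_int N k f \<ge> a" and "a > 0"
  shows "gap_ratio N k f \<ge> ereal (a / b)"
proof (cases "opt_lp N k f = 0")
  case True
  then show ?thesis using opt \<open>a > 0\<close> by (simp add: gap_ratio_def)
next
  case False
  then have pos: "opt_lp N k f > 0" using opt_lp_nonneg[OF inst feas] by simp
  have "opt_lp N k f \<le> b" using opt_lp_le_lp_cost[OF inst feas] cost by simp
  then have "a / b \<le> opt_int N k f / opt_lp N k f"
    using pos opt \<open>a > 0\<close> by (intro frac_le) auto
  then show ?thesis using False by (simp add: gap_ratio_def)
qed

section \<open>Coverage functions and the hypergraph instance\<close>

definition weighted_coverage :: "('b \<Rightarrow> real) \<Rightarrow> ('a \<Rightarrow> 'b) \<Rightarrow> 'a set \<Rightarrow> real" where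
  "weighted_coverage w p S = sum w (p ` S)"

text \<open>Images commute with unions, while the image of an intersection lies inside the
  intersection of the images. So the modular identity for \<open>sum w\<close> becomes the
  submodular inequality.\<close>

lemma mono_instance_weighted_coverage:
  assumes "finite N" and w: "\<And>x. w x \<ge> 0"
  shows "mono_instance N k (\<lambda>i. weighted_coverage w (p i))"
proof -
  have "mono_on (Pow N) (weighted_coverage w (p i))" for i
    unfolding weighted_coverage_def using assms
    by (intro mono_onI sum_mono2) (auto intro: finite_subset)
  moreover have "submodular_on N (weighted_coverage w (p i))" for i
    unfolding submodular_on_def
  proof (intro allI impI)
    fix S T assume "S \<subseteq> N" "T \<subseteq> N"
    then have fin: "finite S" "finite T" using assms(1) finite_subset by blast+
    have "sum w (p i ` (S \<inter> T)) \<le> sum w (p i ` S \<inter> p i ` T)"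
      using fin w by (intro sum_mono2) auto
    moreover have "sum w (p i ` S \<union> p i ` T) + sum w (p i ` S \<inter> p i ` T)
        = sum w (p i ` S) + sum w (p i ` T)"
      using fin by (intro sum.union_inter) auto
    ultimately show "weighted_coverage w (p i) S + weighted_coverage w (p i) T
        \<ge> weighted_coverage w (p i) (S \<union> T) + weighted_coverage w (p i) (S \<inter> T)"
      by (simp add: weighted_coverage_def image_Un)
  qed
  ultimately show ?thesis
    unfolding mono_instance_def using assms by (auto simp: weighted_coverage_def intro: sum_nonneg)
qed

definition vertex_weight :: "nat \<Rightarrow> nat \<Rightarrow> nat \<Rightarrow> real" where
  "vertex_weight k m j = (if j = 0 then real (k * m) else 1)"

text \<open>The threshold is doubled to stay within the naturals.\<close>

definition cover_edges :: "nat \<Rightarrow> nat \<Rightarrow> (nat \<Rightarrow> nat) set" where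
  "cover_edges k m = {e \<in> PiE {1..k} (\<lambda>_. {0..m}). k * m \<le> 2 * (\<Sum>i\<in>{1..k}. e i)}"

definition hypergraph_cost :: "nat \<Rightarrow> nat \<Rightarrow> ('a \<Rightarrow> nat \<Rightarrow> nat) \<Rightarrow> nat \<Rightarrow> 'a set \<Rightarrow> real" where
  "hypergraph_cost k m g i = weighted_coverage (vertex_weight k m) (\<lambda>v. g v i)"

lemma finite_cover_edges: "finite (cover_edges k m)"
  unfolding cover_edges_def
  by (rule finite_subset[of _ "PiE {1..k} (\<lambda>_. {0..m})"]) (auto intro: finite_PiE)

lemma card_cover_edges_le: "card (cover_edges k m) \<le> (m + 1) ^ k"
proof -
  have "card (cover_edges k m) \<le> card (PiE {1..k} (\<lambda>_. {0..m}))"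
    unfolding cover_edges_def by (intro card_mono finite_PiE) auto
  also have "\<dots> = (m + 1) ^ k" by (simp add: card_PiE)
  finally show ?thesis .
qed

lemma cover_edges_nonempty: "cover_edges k m \<noteq> {}"
proof -
  have "restrict (\<lambda>_. m) {1..k} \<in> cover_edges k m" by (auto simp: cover_edges_def)
  then show ?thesis by blast
qed

lemma mono_instance_hypergraph_cost:
  "finite N \<Longrightarrow> mono_instance N k (hypergraph_cost k m g)"
  unfolding hypergraph_cost_def
  by (intro mono_instance_weighted_coverage) (auto simp: vertex_weight_def)

section \<open>Lower bound for integral covers\<close>

lemma allocation_cost_ge:
  assumes "finite N" "g ` N = cover_edges k m" and alloc: "is_allocation N k X"
  shows "real (k * m) / 2 \<le> (\<Sum>i\<in>{1..k}. hypergraph_cost k m g i (X i))"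
proof -
  define C where "C i = (\<lambda>v. g v i) ` X i" for i
  have cost: "hypergraph_cost k m g i (X i) = sum (vertex_weight k m) (C i)" for i
    by (simp add: hypergraph_cost_def weighted_coverage_def C_def)
  have w0: "vertex_weight k m j \<ge> 0" for j by (simp add: vertex_weight_def)
  have XN: "X i \<subseteq> N" if "i \<in> {1..k}" for i
    using alloc that unfolding is_allocation_def by blast
  have finC: "finite (C i)" if "i \<in> {1..k}" for i
    unfolding C_def using XN[OF that] assms(1) finite_subset by blast
  show ?thesis
  proof (cases "\<exists>i\<in>{1..k}. 0 \<in> C i")
    case True
    then obtain i where i: "i \<in> {1..k}" "0 \<in> C i" by blast
    have "real (k * m) = vertex_weight k m 0" by (simp add: vertex_weight_def)
    also have "\<dots> \<le> sum (vertex_weight k m) (C i)"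
      using finC i w0 by (intro member_le_sum) auto
    also have "\<dots> \<le> (\<Sum>i\<in>{1..k}. sum (vertex_weight k m) (C i))"
      using i w0 by (intro member_le_sum[where f = "\<lambda>i. sum (vertex_weight k m) (C i)"] sum_nonneg) auto
    finally show ?thesis unfolding cost using of_nat_0_le_iff[of "k * m"] by linarith
  next
    case False
    \<comment> \<open>The largest uncovered vertex of part \<open>i\<close>. It exists for
      \<open>i\<close> in \<open>{1..k}\<close> because vertex 0 is uncovered in this case.\<close>
    define a where "a i = Max ({0..m} - C i)" for i
    have a_in: "a i \<in> {0..m} - C i" if "i \<in> {1..k}" for i
      unfolding a_def using that False by (intro Max_in) auto
    have above: "{a i<..m} \<subseteq> C i" for i
    proof
      fix j assume j: "j \<in> {a i<..m}"
      show "j \<in> C i"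
      proof (rule ccontr)
        assume "j \<notin> C i"
        then have "j \<le> a i" unfolding a_def using j by (intro Max_ge) auto
        then show False using j by simp
      qed
    qed
    have part: "real m - real (a i) \<le> sum (vertex_weight k m) (C i)" if "i \<in> {1..k}" for i
    proof -
      have "real m - real (a i) = (\<Sum>j\<in>{a i<..m}. 1)"
        using a_in[OF that] by (simp add: of_nat_diff)
      also have "\<dots> = sum (vertex_weight k m) {a i<..m}"
        by (intro sum.cong) (auto simp: vertex_weight_def)
      also have "\<dots> \<le> sum (vertex_weight k m) (C i)"
        using above finC[OF that] w0 by (intro sum_mono2) auto
      finally show ?thesis .
    qed
    \<comment> \<open>Otherwise \<open>a\<close> would be a hyperedge, hence \<open>g v\<close> for
      some \<open>v\<close>. The part \<open>i\<close> that receives \<open>v\<close> would then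
      cover \<open>a i\<close>.\<close>
    have "2 * (\<Sum>i\<in>{1..k}. a i) < k * m"
    proof (rule ccontr)
      assume "\<not> ?thesis"
      moreover have "restrict a {1..k} \<in> PiE {1..k} (\<lambda>_. {0..m})"
        using a_in by auto
      ultimately have "restrict a {1..k} \<in> g ` N"
        unfolding assms(2) cover_edges_def by simp
      then obtain v where v: "v \<in> N" "g v = restrict a {1..k}" by auto
      then obtain i where i: "i \<in> {1..k}" "v \<in> X i"
        using alloc unfolding is_allocation_def by blast
      then have "g v i \<in> C i" by (simp add: C_def)
      then show False using v i a_in by auto
    qed
    then have "real (2 * (\<Sum>i\<in>{1..k}. a i)) < real (k * m)"
      by (simp only: of_nat_less_iff)
    then have "2 * (\<Sum>i\<in>{1..k}. real (a i)) < real (k * m)" by simp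
    then have "real (k * m) / 2 \<le> (\<Sum>i\<in>{1..k}. real m - real (a i))"
      by (simp add: sum_subtractf)
    also have "\<dots> \<le> (\<Sum>i\<in>{1..k}. sum (vertex_weight k m) (C i))"
      using part by (intro sum_mono) auto
    finally show ?thesis unfolding cost .
  qed
qed

section \<open>A cheap fractional cover\<close>

text \<open>Grouping the indices \<open>j\<close> by the value \<open>L j\<close>. It evaluates sums
  over all sets when each set is weighted by the number of levels that produce it.\<close>

lemma sum_fibre_card:
  fixes h :: "'b \<Rightarrow> real"
  assumes "finite A" "finite J" "L ` J \<subseteq> A"
  shows "(\<Sum>S\<in>A. c * real (card {j\<in>J. L j = S}) * h S) = c * (\<Sum>j\<in>J. h (L j))"
proof -
  have "(\<Sum>j\<in>J. h (L j)) = (\<Sum>S\<in>A. \<Sum>j\<in>{j\<in>J. L j = S}. h (L j))"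
    using assms by (intro sum.group[symmetric]) auto
  also have "\<dots> = (\<Sum>S\<in>A. real (card {j\<in>J. L j = S}) * h S)"
    by (intro sum.cong refl) simp
  finally show ?thesis by (simp add: sum_distrib_left mult.assoc)
qed

lemma ex_cheap_fractional_cover:
  assumes "finite N" "g ` N \<subseteq> cover_edges k m" "k \<ge> 1" "m \<ge> 1"
  shows "\<exists>y. lp_feasible N k y \<and> lp_cost N k (hypergraph_cost k m g) y \<le> real m + 1"
proof -
  \<comment> \<open>Half of \<open>k * m\<close>, rounded up: an integral coordinate sum that meets
    the threshold is at least \<open>s\<close>.\<close>
  define s where "s = (k * m + 1) div 2"
  have s: "k * m \<le> 2 * s" unfolding s_def by simp
  have s0: "real s > 0" using s assms(3,4) by (cases s) auto
  have edge: "s \<le> (\<Sum>i\<in>{1..k}. g v i)" "\<And>i. i \<in> {1..k} \<Longrightarrow> g v i \<le> m" if "v \<in> N" for v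
  proof -
    have "g v \<in> cover_edges k m" using assms(2) that by blast
    then show "s \<le> (\<Sum>i\<in>{1..k}. g v i)" "\<And>i. i \<in> {1..k} \<Longrightarrow> g v i \<le> m"
      unfolding cover_edges_def s_def by (auto simp: PiE_def Pi_def)
  qed
  \<comment> \<open>The LP asks for equality, so each hyperedge is first lowered to coordinate sum exactly \<open>s\<close>.\<close>
  have "\<forall>v\<in>N. \<exists>b. (\<forall>i\<in>{1..k}. b i \<le> g v i) \<and> sum b {1..k} = s"
    using ex_le_with_sum_eq edge(1) by blast
  then obtain b where b: "\<And>v i. v \<in> N \<Longrightarrow> i \<in> {1..k} \<Longrightarrow> b v i \<le> g v i"
      "\<And>v. v \<in> N \<Longrightarrow> sum (b v) {1..k} = s"
    by metis
  \<comment> \<open>Each level set \<open>L i j\<close> with \<open>j\<close> in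
    \<open>{1..m}\<close> receives weight \<open>1 / s\<close>; the cardinality in \<open>y\<close>
    handles levels whose sets coincide. An element \<open>v\<close> lies in \<open>b v i\<close> of
    the levels of part \<open>i\<close>, so its total coverage is \<open>s / s\<close>.\<close>
  define L where "L i j = {v\<in>N. j \<le> b v i}" for i j
  define y where "y i S = 1 / real s * real (card {j\<in>{1..m}. L i j = S})" for i S
  have sum_y: "(\<Sum>S\<in>Pow N. y i S * h S) = 1 / real s * (\<Sum>j\<in>{1..m}. h (L i j))"
    for i and h :: "'a set \<Rightarrow> real"
    unfolding y_def using assms(1) by (intro sum_fibre_card) (auto simp: L_def)
  have "lp_feasible N k y"
    unfolding lp_feasible_def
  proof (intro conjI ballI)
    fix v assume v: "v \<in> N"
    have "(\<Sum>j\<in>{1..m}. indicator (L i j) v) = real (b v i)" if i: "i \<in> {1..k}" for i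
    proof -
      have "b v i \<le> m" using b(1)[OF v i] edge(2)[OF v i] by simp
      then have "{j\<in>{1..m}. v \<in> L i j} = {1..b v i}" using v by (auto simp: L_def)
      moreover have "(\<Sum>j\<in>{1..m}. indicator (L i j) v) = real (card {j\<in>{1..m}. v \<in> L i j})"
        by (simp add: indicator_def sum.If_cases Int_def)
      ultimately show ?thesis by simp
    qed
    then have "(\<Sum>i\<in>{1..k}. \<Sum>S\<in>Pow N. y i S * indicator S v)
        = (\<Sum>i\<in>{1..k}. 1 / real s * real (b v i))"
      unfolding sum_y by (intro sum.cong) auto
    also have "\<dots> = 1 / real s * real (sum (b v) {1..k})" by (simp add: sum_divide_distrib)
    also have "\<dots> = 1" using b(2)[OF v] s0 by simp
    finally show "(\<Sum>i\<in>{1..k}. \<Sum>S\<in>Pow N. y i S * indicator S v) = 1" .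
  qed (simp add: y_def)
  moreover have "lp_cost N k (hypergraph_cost k m g) y \<le> real m + 1"
  proof -
    \<comment> \<open>The cost is still measured on \<open>g\<close>, not on the lowered
      \<open>b\<close>. As \<open>j \<le> b v i \<le> g v i \<le> m\<close>, only vertices from
      \<open>j\<close> to \<open>m\<close> are met, and \<open>j \<ge> 1\<close> excludes the heavy
      vertex.\<close>
    have level: "hypergraph_cost k m g i (L i j) \<le> real (m + 1 - j)"
      if "i \<in> {1..k}" "j \<in> {1..m}" for i j
    proof -
      have sub: "(\<lambda>v. g v i) ` L i j \<subseteq> {j..m}"
        using b(1) edge(2) that by (force simp: L_def)
      have "hypergraph_cost k m g i (L i j) \<le> sum (vertex_weight k m) {j..m}"
        unfolding hypergraph_cost_def weighted_coverage_def
        using sub by (intro sum_mono2) (auto simp: vertex_weight_def)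
      also have "\<dots> = (\<Sum>j\<in>{j..m}. 1)"
        using that by (intro sum.cong) (auto simp: vertex_weight_def)
      finally show ?thesis by simp
    qed
    have "(\<Sum>j\<in>{1..m}. m + 1 - j) = (\<Sum>j\<in>{1..m}. j)"
      by (rule sum.reindex_bij_witness[of _ "\<lambda>j. m + 1 - j" "\<lambda>j. m + 1 - j"]) auto
    then have "(\<Sum>j\<in>{1..m}. real (m + 1 - j)) = (\<Sum>j\<in>{1..m}. real j)"
      unfolding of_nat_sum[symmetric] by (rule arg_cong)
    also have "\<dots> = real m * (real m + 1) / 2"
      using double_gauss_sum_from_Suc_0[of m, where 'a = real] by simp
    finally have sum_m: "(\<Sum>j\<in>{1..m}. real (m + 1 - j)) = real m * (real m + 1) / 2" .
    have "lp_cost N k (hypergraph_cost k m g) y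
        = (\<Sum>i\<in>{1..k}. 1 / real s * (\<Sum>j\<in>{1..m}. hypergraph_cost k m g i (L i j)))"
      unfolding lp_cost_def sum_y ..
    also have "\<dots> \<le> (\<Sum>i\<in>{1..k}. 1 / real s * (\<Sum>j\<in>{1..m}. real (m + 1 - j)))"
      using s0 level by (intro sum_mono mult_left_mono) auto
    also have "\<dots> = real (k * m) * (real m + 1) / (2 * real s)"
      unfolding sum_m by (simp add: field_simps)
    also have "\<dots> \<le> real (2 * s) * (real m + 1) / (2 * real s)"
      using s s0 by (intro divide_right_mono mult_right_mono of_nat_mono) auto
    also have "\<dots> = real m + 1" using s0 by simp
    finally show ?thesis .
  qed
  ultimately show ?thesis by blast
qed

section \<open>The gap as a function of \<open>m\<close>, and the choice of \<open>m\<close>\<close>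

lemma integrality_gap_ge:
  assumes "k \<ge> 1" "m \<ge> 1" "(m + 1) ^ k \<le> n"
  shows "integrality_gap n k \<ge> ereal (real k / 2 - real k / (2 * (real m + 1)))"
proof -
  obtain g where g: "g ` {..<n} = cover_edges k m"
    using obtain_surj_from_lessThan[OF finite_cover_edges cover_edges_nonempty]
      card_cover_edges_le[of k m] assms(3) by (metis le_trans)
  let ?f = "hypergraph_cost k m g"
  have inst: "mono_instance {..<n} k ?f" by (simp add: mono_instance_hypergraph_cost)
  obtain y where y: "lp_feasible {..<n} k y" "lp_cost {..<n} k ?f y \<le> real m + 1"
    using ex_cheap_fractional_cover[of "{..<n}" g k m] g assms by auto
  have "opt_int {..<n} k ?f \<ge> real (k * m) / 2"
    using assms(1) g by (intro le_opt_int allocation_cost_ge[where N = "{..<n}"]) auto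
  then have "gap_ratio {..<n} k ?f \<ge> ereal (real (k * m) / 2 / (real m + 1))"
    using assms by (intro gap_ratio_ge[OF inst y]) auto
  also have "real (k * m) / 2 / (real m + 1) = real k / 2 - real k / (2 * (real m + 1))"
    by (simp add: field_simps)
  finally show ?thesis
    unfolding integrality_gap_def using inst
    by (intro Sup_upper2[of "gap_ratio {..<n} k ?f"]) (auto intro!: exI[of _ "{..<n}"])
qed

text \<open>Halving both sides reduces this to \<open>exp x \<ge> 1 + x\<close> at
  \<open>x = ln 2 * (t - 1)\<close>, together with \<open>ln 2 \<ge> 1 / 2\<close>. With
  \<open>t = log 2 n / k\<close> it yields \<open>(m + 1) ^ k \<le> n\<close>.\<close>

lemma add_one_le_two_powr:
  fixes t :: real
  assumes "t \<ge> 1"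
  shows "t + 1 \<le> 2 powr t"
proof -
  have "1 / 2 \<le> ln (2 :: real)"
    using ln_le_minus_one[of "1 / 2 :: real"] by (simp add: ln_div)
  then have "(1 / 2) * (t - 1) \<le> ln 2 * (t - 1)"
    using assms by (intro mult_right_mono) auto
  then have "1 + (t - 1) / 2 \<le> exp (ln 2 * (t - 1))"
    using exp_ge_add_one_self[of "ln 2 * (t - 1)"] by linarith
  also have "\<dots> = 2 powr t / 2" by (simp add: powr_def mult.commute[of "ln 2"] left_diff_distrib exp_diff)
  finally show ?thesis by (simp add: field_simps)
qed

theorem theorem3:
  fixes k n :: nat
  assumes "k \<ge> 2" and "n > 0" and "log 2 (real n) \<ge> real k"
  shows "integrality_gap n k \<ge>
           ereal (real k / 2 - real k * (real k - 1) / log 2 (real n))"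
proof -
  define l where "l = log 2 (real n)"
  define t where "t = l / real k"
  define m where "m = nat \<lfloor>t\<rfloor>"
  have k0: "real k > 0" using assms by simp
  then have l0: "l > 0" using assms(3) unfolding l_def by linarith
  have t1: "t \<ge> 1" using assms by (simp add: t_def l_def)
  have m: "m \<ge> 1" "real m \<le> t" "t \<le> real m + 1"
    using t1 unfolding m_def by linarith+
  have "real ((m + 1) ^ k) \<le> (2 powr t) ^ k"
    using m(2) add_one_le_two_powr[OF t1] by (simp add: power_mono)
  also have "\<dots> = 2 powr l" using k0 by (simp add: powr_power t_def)
  also have "\<dots> = real n" using assms(2) by (simp add: l_def)
  finally have "(m + 1) ^ k \<le> n" by (simp only: of_nat_le_iff)
  then have gap: "integrality_gap n k \<ge> ereal (real k / 2 - real k / (2 * (real m + 1)))"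
    using m(1) assms(1) by (intro integrality_gap_ge) auto
  \<comment> \<open>Rounding \<open>t\<close> down costs less than one, and
    \<open>k \<le> 2 * (k - 1)\<close> since \<open>k \<ge> 2\<close>. Together they turn the loss
    \<open>k / (2 * (m + 1))\<close> into \<open>k * (k - 1) / l\<close>.\<close>
  have "l \<le> real k * (real m + 1)" using m(3) k0 by (simp add: t_def field_simps)
  also have "\<dots> \<le> (2 * (real k - 1)) * (real m + 1)"
    using assms(1) by (intro mult_right_mono) auto
  finally have "real k * l \<le> real k * ((real k - 1) * (2 * (real m + 1)))"
    using k0 by (intro mult_left_mono) (auto simp: algebra_simps)
  then have "real k / (2 * (real m + 1)) \<le> real k * (real k - 1) / l"
    using l0 by (simp add: field_simps)
  then have "ereal (real k / 2 - real k * (real k - 1) / l)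
      \<le> ereal (real k / 2 - real k / (2 * (real m + 1)))" by simp
  also note gap
  finally show ?thesis unfolding l_def .
qed

end
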